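(* There exists a polynomial $f \in \mathbb{C}[x,y]$ such that no polynomial $g \in \mathbb{R}[x,y]$ (regarded as an element of $\mathbb{C}[x,y]$) is topologically equivalent to $f$.
   Context: Two polynomials $f,g \in \mathbb{C}[x,y]$, viewed as maps $\mathbb{C}^2 \to \mathbb{C}$, are called topologically equivalent, written $f \approx g$, if there exist homeomorphisms $\Phi : \mathbb{C}^2 \to \mathbb{C}^2$ and $\Psi : \mathbb{C} \to \mathbb{C}$ such that $g \circ \Phi = \Psi \circ f$. *)

theory Defs
  imports "HOL-Analysis.Analysis" "HOL-Computational_Algebra.Polynomial"
begin

(* The ring R[x,y] is rendered as (R[x])[y], i.e. as the type 'a poly poly:
   the coefficient of x^i y^j in p is coeff (coeff p j) i. *)

definition eval2 :: "'a::comm_semiring_0 poly poly \<Rightarrow> 'a \<times> 'a \<Rightarrow> 'a" where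
  "eval2 p = (\<lambda>(x, y). poly (poly p [:y:]) x)"

lemma eval2_monom: "eval2 (monom (monom c i) j) (x, y) = c * x ^ i * y ^ j"
  for c x y :: "'a::comm_ring_1"
  by (simp add: eval2_def poly_monom)

lemma eval2_add: "eval2 (p + q) z = eval2 p z + eval2 q z"
  for p q :: "'a::comm_ring_1 poly poly"
  by (simp add: eval2_def split: prod.split)

definition complexify :: "real poly poly \<Rightarrow> complex poly poly" where
  "complexify p = map_poly (map_poly complex_of_real) p"

lemma coeff_complexify:
  "coeff (coeff (complexify p) j) i = complex_of_real (coeff (coeff p j) i)"
  by (simp add: complexify_def coeff_map_poly)

definition top_equivalent :: "complex poly poly \<Rightarrow> complex poly poly \<Rightarrow> bool"
    (infix "\<approx>\<^sub>t\<^sub>o\<^sub>p" 50) where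
  "f \<approx>\<^sub>t\<^sub>o\<^sub>p g \<longleftrightarrow>
    (\<exists>(\<Phi> :: complex \<times> complex \<Rightarrow> complex \<times> complex) \<Phi>' (\<Psi> :: complex \<Rightarrow> complex) \<Psi>'.
      homeomorphism UNIV UNIV \<Phi> \<Phi>' \<and> homeomorphism UNIV UNIV \<Psi> \<Psi>' \<and>
      eval2 g \<circ> \<Phi> = \<Psi> \<circ> eval2 f)"

end

theory Submission
  imports Defs "HOL-Complex_Analysis.Complex_Analysis"
    "HOL-Computational_Algebra.Fundamental_Theorem_Algebra"
begin

text \<open>
  The polynomial is \<open>f (x, y) = P x\<close> with \<open>P = x\<^sup>3 (x - a)\<^sup>2 (x - b)\<close>, where the complex numbers \<open>a\<close> and \<open>b\<close>
  are chosen such that the critical points are \<open>0\<close>, \<open>a\<close> and \<open>1\<close>, the last one being of order 3. So the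
  only critical values are \<open>0\<close> and \<open>c = P 1\<close>. The preimage of an arc joining them is a plane tree: the
  vertex \<open>1\<close> has three neighbours, \<open>0\<close>, \<open>a\<close> and \<open>b\<close>, and these have the distinct valencies 3, 2 and 1.
  A reflection of the plane can fix at most two of the three edges at the vertex \<open>1\<close>, but it would have
  to fix all of them, because their other ends cannot be interchanged. In other words, the tree differs
  from its mirror image, and a real polynomial has a tree that agrees with its mirror image.

  The proof makes this precise without orientations and without determining the tree. If \<open>f\<close> is
  equivalent to a real polynomial, then complex conjugation, which commutes with the real polynomial,
  becomes an involution of the source of \<open>f\<close> that permutes the fibres of \<open>f\<close>. It
  permutes the components of the fibres, that is, the lines \<open>x = const\<close>, and so it descends to an
  involution \<open>s\<close> of the \<open>x\<close>-plane lying over a map \<open>\<tau>\<close> that is conjugate to complex conjugation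
  (\<open>equivalence_to_real_gives_symmetry\<close>). The order of a point as a root of \<open>P - P z\<close> is visible in the
  topology of \<open>P\<close> (\<open>order_iff_fibre_near\<close>). Hence \<open>s\<close> fixes \<open>0\<close>, \<open>a\<close>, \<open>b\<close> and \<open>1\<close>, and both critical
  values are fixed by \<open>\<tau>\<close>, so that they are joined by an arc of fixed points of \<open>\<tau>\<close>.

  Lifts of this arc that start at \<open>1\<close> end at \<open>0\<close>, \<open>a\<close> or \<open>b\<close>, and \<open>s\<close> maps each of them to one with the
  same ends. Two different ones would bound a cycle in the preimage of the arc, contrary to the maximum
  principle (\<open>arc_lifts_with_same_ends_agree\<close>). So \<open>s\<close> fixes the lifts pointwise, although it reverses the
  cyclic motion around \<open>1\<close> that permutes them. Following a small loop around \<open>c\<close>, one finds that its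
  lift near \<open>1\<close> closes up after two turns, which forces the order of the critical point to divide 2
  (\<open>real_symmetry_order_dvd_2\<close>). But the order is 3.
\<close>

section \<open>Roots of a polynomial under perturbation\<close>

lemma degree_minus_const:
  fixes p :: "complex poly"
  assumes "degree p > 0"
  shows "degree (p - [:c:]) = degree p"
proof -
  have "p - [:c:] = p + [:- c:]" by simp
  then show ?thesis
    using degree_add_eq_left[of "[:- c:]" p] assms by (metis degree_pCons_0)
qed

lemma minus_const_nonzero:
  fixes p :: "complex poly"
  assumes "degree p > 0"
  shows "p - [:c:] \<noteq> 0"
  using degree_minus_const[OF assms, of c] assms by auto

text \<open>
  The modulus of \<open>p - c\<close> at \<open>x\<close> is that of the leading coefficient times the product of the
  distances from \<open>x\<close> to the roots; if it is small, one of the distances is small.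
\<close>

lemma poly_near_root:
  fixes p :: "complex poly"
  assumes "degree p > 0" "e > 0"
  obtains d where "d > 0"
    "\<And>x. cmod (poly p x - c) < d \<Longrightarrow> \<exists>z. poly p z = c \<and> dist z x < e"
proof -
  define q where "q = p - [:c:]"
  have deg: "degree q = degree p"
    unfolding q_def by (rule degree_minus_const[OF assms(1)])
  have "q \<noteq> 0"
    using deg assms(1) by auto
  obtain root where root: "smult (lead_coeff q) (\<Prod>i<degree q. [:- root i, 1:]) = q"
    using complex_poly_decompose' by blast
  have val: "poly q x = lead_coeff q * (\<Prod>i<degree q. x - root i)" for x
    by (subst root [symmetric]) (simp add: poly_prod)
  define d where "d = cmod (lead_coeff q) * e ^ degree q"
  have "d > 0"
    using \<open>q \<noteq> 0\<close> assms(2) by (simp add: d_def)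
  moreover have "\<exists>z. poly p z = c \<and> dist z x < e" if "cmod (poly p x - c) < d" for x
  proof (rule ccontr)
    assume none: "\<not> ?thesis"
    have "poly q (root i) = 0" if "i < degree q" for i
      unfolding val using that by auto
    then have "e \<le> cmod (x - root i)" if "i < degree q" for i
      using none that by (force simp: q_def dist_norm norm_minus_commute)
    then have "(\<Prod>i<degree q. e) \<le> (\<Prod>i<degree q. cmod (x - root i))"
      using assms(2) by (intro prod_mono) auto
    then have "d \<le> cmod (poly q x)"
      by (simp add: val d_def norm_mult prod_norm mult_left_mono)
    then show False
      using that by (simp add: q_def)
  qed
  ultimately show thesis
    using that by blast
qed

lemma poly_roots_separated:
  fixes p :: "complex poly"
  assumes "degree p > 0"
  obtains e where "e > 0"
    "\<And>z z'. poly p z = c \<Longrightarrow> poly p z' = c \<Longrightarrow> dist z z' < 2 * e \<Longrightarrow> z = z'"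
proof -
  have "p - [:c:] \<noteq> 0"
    by (rule minus_const_nonzero[OF assms])
  then have fin: "finite {z. poly p z = c}"
    using poly_roots_finite[of "p - [:c:]"] by simp
  define D where "D = (\<lambda>(x, y). dist x y) ` ({z. poly p z = c} \<times> {z. poly p z = c} - Id)"
  have D: "finite (insert 1 D)"
    using fin by (simp add: D_def)
  have pos: "d > 0" if "d \<in> insert 1 D" for d
    using that unfolding D_def by (elim insertE imageE) (simp_all split: prod.splits)
  define m where "m = Min (insert 1 D)"
  have "m \<in> insert 1 D"
    unfolding m_def using D by (intro Min_in) auto
  then have "m / 2 > 0"
    using pos by simp
  moreover have "z = z'" if "poly p z = c" "poly p z' = c" "dist z z' < 2 * (m / 2)" for z z'
  proof (rule ccontr)
    assume "z \<noteq> z'"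
    then have "dist z z' \<in> D"
      using that unfolding D_def by (intro image_eqI[of _ _ "(z, z')"]) auto
    then have "m \<le> dist z z'"
      unfolding m_def using D by (intro Min_le) auto
    with that(3) show False by simp
  qed
  ultimately show thesis
    using that by blast
qed

text \<open>
  Discs of radius \<open>e\<close> around the roots of \<open>p = c\<close> are disjoint, and they contain every point
  whose value is \<open>d\<close>-close to \<open>c\<close>. A connected set of such points cannot jump from one disc to
  another. This is what controls lifts near the critical points, where \<open>p\<close> is not a covering.
\<close>

lemma lift_stays_near_root:
  fixes p :: "complex poly" and g :: "'a::topological_space \<Rightarrow> complex"
  assumes near: "\<And>x. cmod (poly p x - c) < d \<Longrightarrow> \<exists>z. poly p z = c \<and> dist z x < e"
    and sep: "\<And>z z'. poly p z = c \<Longrightarrow> poly p z' = c \<Longrightarrow> dist z z' < 2 * e \<Longrightarrow> z = z'"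
    and g: "continuous_on T g" "connected T" "\<And>t. t \<in> T \<Longrightarrow> cmod (poly p (g t) - c) < d"
    and z: "poly p z = c" "t0 \<in> T" "dist z (g t0) < e"
    and t: "t \<in> T"
  shows "dist z (g t) < e"
proof (rule ccontr)
  assume far: "\<not> ?thesis"
  let ?B = "\<Union>z' \<in> {z'. poly p z' = c \<and> z' \<noteq> z}. ball z' e"
  have "connected (g ` T)"
    using g(1,2) by (rule connected_continuous_image)
  moreover have "g ` T \<subseteq> ball z e \<union> ?B"
    using near g(3) by (fastforce simp: dist_commute)
  moreover have "ball z e \<inter> ?B = {}"
  proof (rule ccontr)
    assume "ball z e \<inter> ?B \<noteq> {}"
    then obtain x where x: "x \<in> ball z e" "x \<in> ?B" by blast
    from x(2) obtain z' where "poly p z' = c" "z' \<noteq> z" "x \<in> ball z' e" by blast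
    with x(1) have "dist z x < e" "poly p z' = c" "z' \<noteq> z" "dist z' x < e" by auto
    moreover from this have "dist z z' < 2 * e"
      using dist_triangle2[of z z' x] by simp
    ultimately show False
      using sep z(1) by metis
  qed
  moreover have "ball z e \<inter> g ` T \<noteq> {}"
    using z by auto
  moreover have "?B \<inter> g ` T \<noteq> {}"
  proof -
    obtain z' where "poly p z' = c" "dist z' (g t) < e"
      using near[OF g(3)[OF t]] by blast
    then have "g t \<in> ?B"
      using far by (intro UN_I[of z']) auto
    then show ?thesis using t by blast
  qed
  moreover have "open (ball z e)" "open ?B"
    by auto
  ultimately show False
    using connectedD[of "g ` T" "ball z e" ?B] by blast
qed

text \<open>
  A lift over a convergent arc stays near one root of the limit value, for every degree of
  nearness; as the roots are separated, it is always the same root, which is the limit of the lift.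
\<close>

lemma lift_has_limit:
  fixes p :: "complex poly" and g :: "real \<Rightarrow> complex"
  assumes "degree p > 0" and T: "convex T" "at a within T \<noteq> bot"
    and g: "continuous_on T g" "((\<lambda>t. poly p (g t)) \<longlongrightarrow> c) (at a within T)" "a \<notin> T"
  obtains z where "(g \<longlongrightarrow> z) (at a within T)" "poly p z = c"
proof -
  obtain e0 where e0: "e0 > 0"
    and sep: "\<And>z z'. poly p z = c \<Longrightarrow> poly p z' = c \<Longrightarrow> dist z z' < 2 * e0 \<Longrightarrow> z = z'"
    using poly_roots_separated[OF assms(1)] by blast
  obtain d0 where d0: "d0 > 0"
    and near: "\<And>x. cmod (poly p x - c) < d0 \<Longrightarrow> \<exists>z. poly p z = c \<and> dist z x < e0"
    using poly_near_root[OF assms(1) e0] by blast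
  obtain \<delta> where \<delta>: "\<delta> > 0" "\<And>t. t \<in> T \<Longrightarrow> dist t a < \<delta> \<Longrightarrow> cmod (poly p (g t) - c) < d0"
    using tendstoD[OF g(2) d0] g(3) unfolding eventually_at dist_norm by metis
  define U where "U = T \<inter> ball a \<delta>"
  have U: "connected U" "continuous_on U g" "\<And>t. t \<in> U \<Longrightarrow> cmod (poly p (g t) - c) < d0"
    using T(1) g(1) \<delta>(2) by (auto simp: U_def dist_commute convex_Int convex_connected intro: continuous_on_subset)
  have "U \<noteq> {}"
  proof
    assume "U = {}"
    then have "eventually (\<lambda>t. False) (at a within T)"
      using \<delta>(1) unfolding eventually_at U_def by (intro exI[of _ \<delta>]) (auto simp: dist_commute)
    then show False using T(2) by simp
  qed
  then obtain t0 where t0: "t0 \<in> U" by auto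
  obtain z where z: "poly p z = c" "dist z (g t0) < e0"
    using near[OF U(3)[OF t0]] by auto
  have stay: "dist z (g t) < e0" if "t \<in> U" for t
    using lift_stays_near_root[OF near sep U(2,1,3) z(1) t0 z(2) that] .
  have "(g \<longlongrightarrow> z) (at a within T)"
  proof (rule tendstoI)
    fix e :: real assume "e > 0"
    then obtain d where d: "d > 0"
      and near': "\<And>x. cmod (poly p x - c) < d \<Longrightarrow> \<exists>z. poly p z = c \<and> dist z x < min e e0"
      using poly_near_root[OF assms(1), of "min e e0"] e0 by (metis min_less_iff_conj)
    have "\<forall>\<^sub>F t in at a within T. cmod (poly p (g t) - c) < d"
      using tendstoD[OF g(2) d] by (simp add: dist_norm)
    moreover have "\<forall>\<^sub>F t in at a within T. t \<in> U"
      using \<delta>(1) unfolding eventually_at U_def by (intro exI[of _ \<delta>]) (auto simp: dist_commute)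
    ultimately show "\<forall>\<^sub>F t in at a within T. dist (g t) z < e"
    proof eventually_elim
      case (elim t)
      obtain z' where z': "poly p z' = c" "dist z' (g t) < min e e0"
        using near'[OF elim(1)] by blast
      have "z = z'"
        using sep[OF z(1) z'(1)] stay[OF elim(2)] z'(2) dist_triangle2[of z z' "g t"] by simp
      then show ?case using z'(2) by (simp add: dist_commute)
    qed
  qed
  then show thesis using that z(1) by blast
qed

section \<open>Polynomials as branched coverings\<close>

lemma poly_not_constant:
  fixes p :: "complex poly"
  assumes "degree p > 0"
  shows "\<not> poly p constant_on UNIV"
proof
  assume "poly p constant_on UNIV"
  then obtain c where "\<And>x. poly p x = c"
    by (auto simp: constant_on_def)
  then have "p - [:c:] = 0"
    by (intro poly_all_0_iff_0[THEN iffD1]) auto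
  then show False
    using assms by simp
qed

lemma holomorphic_on_poly [holomorphic_intros]: "poly p holomorphic_on A"
  by (meson field_differentiable_at_within field_differentiable_def holomorphic_on_def poly_DERIV)

lemma open_poly_image:
  fixes p :: "complex poly"
  assumes "degree p > 0" "open U"
  shows "open (poly p ` U)"
  using open_mapping_thm[OF holomorphic_on_poly open_UNIV connected_UNIV assms(2) subset_UNIV]
    poly_not_constant[OF assms(1)] by blast

text \<open>
  Around a noncritical value the sheets are cut out of small discs about the roots, on which
  \<open>p\<close> is injective and open. By the estimate on distances to roots, these discs contain the full
  preimage of a small neighbourhood of the value, so no sheets are missed.
\<close>

lemma poly_covering_space:
  fixes p :: "complex poly"
  assumes deg: "degree p > 0"
    and S: "open S" "\<And>z. poly (pderiv p) z = 0 \<Longrightarrow> poly p z \<notin> S"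
  shows "covering_space (poly p -` S) (poly p) S"
proof
  show "continuous_on (poly p -` S) (poly p)"
    by (intro continuous_intros)
  show "poly p ` (poly p -` S) = S"
  proof -
    have "\<exists>x. poly p x = c" for c
      using alg_closed_imp_poly_has_root[of "p - [:c:]"] deg by (simp add: degree_minus_const)
    then show ?thesis by (auto simp: image_iff) (metis)
  qed
next
  fix c assume "c \<in> S"
  obtain e0 where e0: "e0 > 0"
    and sep: "\<And>z z'. poly p z = c \<Longrightarrow> poly p z' = c \<Longrightarrow> dist z z' < 2 * e0 \<Longrightarrow> z = z'"
    using poly_roots_separated[OF deg] by blast
  define R where "R = {z. poly p z = c}"
  have "p - [:c:] \<noteq> 0"
    by (rule minus_const_nonzero[OF deg])
  then have fin: "finite R"
    using poly_roots_finite[of "p - [:c:]"] by (simp add: R_def)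
  have "\<exists>r>0. inj_on (poly p) (ball z r)" if "z \<in> R" for z
  proof -
    have "deriv (poly p) z \<noteq> 0"
      using S(2)[of z] that \<open>c \<in> S\<close> by (auto simp: R_def DERIV_imp_deriv[OF poly_DERIV])
    then show ?thesis
      using has_complex_derivative_locally_injective[of "poly p" UNIV z]
      by (metis UNIV_I holomorphic_on_poly open_UNIV)
  qed
  then obtain r where r: "\<And>z. z \<in> R \<Longrightarrow> r z > 0" "\<And>z. z \<in> R \<Longrightarrow> inj_on (poly p) (ball z (r z))"
    by metis
  define e where "e = Min (insert e0 (r ` R))"
  have e: "e > 0" "e \<le> e0" "\<And>z. z \<in> R \<Longrightarrow> e \<le> r z"
    using fin r(1) e0 by (auto simp: e_def)
  have inj: "inj_on (poly p) (ball z e)" if "z \<in> R" for z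
    using r(2)[OF that] e(3)[OF that] by (auto intro: inj_on_subset)
  obtain d where d: "d > 0" "\<And>x. cmod (poly p x - c) < d \<Longrightarrow> \<exists>z. poly p z = c \<and> dist z x < e"
    using poly_near_root[OF deg e(1)] by blast
  define W where "W = ball c d \<inter> S \<inter> (\<Inter>z\<in>R. poly p ` ball z e)"
  have "open W"
    unfolding W_def using fin S(1) by (intro open_Int open_INT ballI open_poly_image[OF deg]) auto
  moreover have "c \<in> poly p ` ball z e" if "z \<in> R" for z
    using that e(1) by (intro image_eqI[of _ _ z]) (simp_all add: R_def)
  then have "c \<in> W"
    using d(1) \<open>c \<in> S\<close> by (simp add: W_def)
  moreover have "W \<subseteq> S"
    unfolding W_def by blast
  ultimately have W: "open W" "c \<in> W" "W \<subseteq> S"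
    by blast+
  define v where "v = (\<lambda>z. ball z e \<inter> poly p -` W) ` R"
  have openv: "open u" if "u \<in> v" for u
  proof -
    have "open (poly p -` W)"
      using W(1) by (intro open_vimage continuous_intros)
    then show ?thesis
      using that by (auto simp: v_def)
  qed
  have "\<exists>z\<in>R. x \<in> ball z e" if "poly p x \<in> W" for x
    using d(2)[of x] that by (auto simp: W_def R_def dist_norm norm_minus_commute)
  then have cover: "\<Union>v = poly p -` S \<inter> poly p -` W"
    using W(3) unfolding v_def by blast
  have openin_v: "\<forall>u\<in>v. openin (top_of_set (poly p -` S)) u"
    using openv cover by (intro ballI open_subset) blast+
  have disj: "pairwise disjnt v"
  proof (rule pairwiseI)
    fix u u' assume "u \<in> v" "u' \<in> v" "u \<noteq> u'"
    then obtain z z' where z: "z \<in> R" "z' \<in> R" "z \<noteq> z'" "u \<subseteq> ball z e" "u' \<subseteq> ball z' e"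
      by (auto simp: v_def)
    have False if "x \<in> u" "x \<in> u'" for x
      using z that sep[of z z'] dist_triangle2[of z z' x] e(2) by (force simp: R_def)
    then show "disjnt u u'"
      by (auto simp: disjnt_def)
  qed
  have sheet: "\<exists>q. homeomorphism u W (poly p) q" if u: "u \<in> v" for u
  proof -
    obtain z where z: "z \<in> R" "u = ball z e \<inter> poly p -` W"
      using u unfolding v_def by blast
    show ?thesis
    proof (rule homeomorphism_injective_open_map)
      show "continuous_on u (poly p)"
        by (intro continuous_intros)
      show "poly p ` u = W"
      proof -
        have "W \<subseteq> poly p ` ball z e"
          unfolding W_def using z(1) by blast
        then show ?thesis unfolding z(2) by blast
      qed
      show "inj_on (poly p) u"
        using inj[OF z(1)] z(2) by (auto intro: inj_on_subset)
      fix U assume "openin (top_of_set u) U"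
      then have "open U"
        using openv[OF u] openin_open_eq by blast
      then have "open (poly p ` U)"
        by (rule open_poly_image[OF deg])
      moreover have "poly p ` U \<subseteq> W"
        using openin_imp_subset[OF \<open>openin (top_of_set u) U\<close>] z(2) by blast
      ultimately show "openin (top_of_set W) (poly p ` U)"
        by (intro open_subset)
    qed auto
  qed
  have "openin (top_of_set S) W"
    using W by (intro open_subset)
  with W(2) cover openin_v disj sheet show "\<exists>T. c \<in> T \<and> openin (top_of_set S) T \<and>
      (\<exists>v. \<Union>v = poly p -` S \<inter> poly p -` T \<and>
        (\<forall>u\<in>v. openin (top_of_set (poly p -` S)) u) \<and> pairwise disjnt v \<and>
        (\<forall>u\<in>v. \<exists>q. homeomorphism u T (poly p) q))"
    by meson
qed

text \<open>
  The arc may begin and end at critical values: its interior is lifted in the covering, and the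
  lift is then extended to its two limits.
\<close>

lemma lift_arc_through_point:
  fixes p :: "complex poly" and \<alpha> :: "real \<Rightarrow> complex"
  assumes deg: "degree p > 0"
    and S: "open S" "\<And>z. poly (pderiv p) z = 0 \<Longrightarrow> poly p z \<notin> S"
    and \<alpha>: "continuous_on {0..1} \<alpha>" "\<alpha> ` {0<..<1} \<subseteq> S"
    and t0: "t0 \<in> {0<..<1}" "poly p z = \<alpha> t0"
  obtains g where "continuous_on {0..1} g" "g t0 = z" "\<And>t. t \<in> {0..1} \<Longrightarrow> poly p (g t) = \<alpha> t"
proof -
  have con: "continuous_on {0<..<1} \<alpha>"
    using \<alpha>(1) by (rule continuous_on_subset) auto
  have zin: "z \<in> poly p -` S"
    using t0 \<alpha>(2) by auto
  obtain g where g: "continuous_on {0<..<1} g" "g \<in> {0<..<1} \<rightarrow> poly p -` S" "g t0 = z"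
    "\<And>t. t \<in> {0<..<1} \<Longrightarrow> poly p (g t) = \<alpha> t"
    using covering_space_lift_strong[OF poly_covering_space[OF deg S] zin t0(1)
        convex_imp_simply_connected convex_imp_locally_path_connected con]
      \<alpha>(2) t0(2) by (metis convex_real_interval(8) image_subset_iff_funcset)
  have lim: "\<exists>z. (g \<longlongrightarrow> z) (at a within {0<..<1}) \<and> poly p z = \<alpha> a" if "a \<in> {0,1}" for a
  proof -
    have "(\<alpha> \<longlongrightarrow> \<alpha> a) (at a within {0<..<1})"
      using \<alpha>(1) that unfolding continuous_on_def
      by (metis atLeastAtMost_iff greaterThanLessThan_subseteq_atLeastAtMost_iff insertE order_refl singletonD tendsto_within_subset zero_le_one)
    then have 1: "((\<lambda>t. poly p (g t)) \<longlongrightarrow> \<alpha> a) (at a within {0<..<1})"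
      by (rule Lim_transform_eventually) (use g(4) in \<open>auto simp: eventually_at_filter\<close>)
    have 2: "at a within {0<..<1} \<noteq> bot" "a \<notin> {0<..<1}"
      using that by (auto simp: trivial_limit_within islimpt_greaterThanLessThan1 islimpt_greaterThanLessThan2)
    show ?thesis
      by (rule lift_has_limit[OF deg convex_real_interval(8) 2(1) g(1) 1 2(2)]) blast
  qed
  obtain z0 z1 where z01: "(g \<longlongrightarrow> z0) (at 0 within {0<..<1})" "poly p z0 = \<alpha> 0"
    "(g \<longlongrightarrow> z1) (at 1 within {0<..<1})" "poly p z1 = \<alpha> 1"
    using lim[of 0] lim[of 1] by auto
  define h where "h = (\<lambda>t. if t = 0 then z0 else if t = 1 then z1 else g t)"
  have "continuous_on {0..1} h"
    unfolding continuous_on_def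
  proof
    fix a :: real assume a: "a \<in> {0..1}"
    have "at a within {0..1} = at a within {0<..<1}"
    proof (cases "a \<in> {0<..<1}")
      case True
      then show ?thesis
        using at_within_Icc_at[of 0 a 1] at_within_open[OF True] by simp
    next
      case False
      then have "a = 0 \<or> a = 1" using a by auto
      then show ?thesis
        by (intro at_within_nhd[of _ "ball a 1"]) (auto simp: dist_real_def)
    qed
    moreover have "(g \<longlongrightarrow> h a) (at a within {0<..<1})"
    proof -
      consider "a = 0" | "a = 1" | "a \<in> {0<..<1}" using a by force
      then show ?thesis
        using z01(1,3) g(1) unfolding h_def continuous_on_def by cases simp_all
    qed
    then have "(h \<longlongrightarrow> h a) (at a within {0<..<1})"
      by (rule Lim_transform_eventually) (auto simp: eventually_at_filter h_def)
    ultimately show "(h \<longlongrightarrow> h a) (at a within {0..1})"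
      by simp
  qed
  moreover have "poly p (h t) = \<alpha> t" if "t \<in> {0..1}" for t
    using that g(4) z01 by (auto simp: h_def)
  moreover have "h t0 = z"
    using t0(1) g(3) by (auto simp: h_def)
  ultimately show thesis
    using that by blast
qed

section \<open>No cycles over a nonseparating set\<close>

text \<open>
  A maximum principle. If \<open>p\<close> maps a Jordan curve into \<open>A\<close>, then the image of the inside is open
  and bounded, and all of its boundary lies in \<open>A\<close>. As the complement of \<open>A\<close> is connected and
  unbounded, the image would have to be contained in \<open>A\<close>, which has no interior. When \<open>A\<close> is an arc,
  this says that the preimage of \<open>A\<close> contains no cycle.
\<close>

lemma poly_loop_not_over_nonseparating_set:
  fixes p :: "complex poly" and \<gamma> :: "real \<Rightarrow> complex"
  assumes deg: "degree p > 0"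
    and A: "bounded A" "connected (- A)" "interior A = {}"
    and \<gamma>: "simple_path \<gamma>" "pathfinish \<gamma> = pathstart \<gamma>"
  shows "\<not> poly p ` path_image \<gamma> \<subseteq> A"
proof
  assume over: "poly p ` path_image \<gamma> \<subseteq> A"
  define W where "W = inside (path_image \<gamma>)"
  define V where "V = poly p ` W"
  have W: "W \<noteq> {}" "open W" "bounded W" "frontier W = path_image \<gamma>"
    using Jordan_inside_outside[OF \<gamma>] by (auto simp: W_def)
  have "open V"
    unfolding V_def by (rule open_poly_image[OF deg W(2)])
  have "compact (poly p ` closure W)"
    using W(3) by (intro compact_continuous_image continuous_intros) (simp add: compact_closure)
  moreover have "V \<subseteq> poly p ` closure W"
    unfolding V_def using closure_subset by blast
  ultimately have V: "bounded V" "closure V \<subseteq> poly p ` closure W"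
    by (meson bounded_subset compact_imp_bounded, meson closure_minimal compact_imp_closed)
  have "frontier V \<subseteq> A"
  proof
    fix x assume x: "x \<in> frontier V"
    then have "x \<in> closure V" "x \<notin> V"
      using \<open>open V\<close> by (auto simp: frontier_def interior_open)
    with V(2) obtain y where y: "y \<in> closure W" "x = poly p y" by blast
    with \<open>x \<notin> V\<close> have "y \<notin> W" by (auto simp: V_def)
    then have "y \<in> frontier W"
      using y W(2) by (simp add: frontier_def interior_open)
    then show "x \<in> A"
      using W(4) over y(2) by blast
  qed
  moreover have "- A \<inter> V \<noteq> {}"
    using A(3) \<open>open V\<close> W(1) interior_maximal[of V A] by (auto simp: V_def)
  moreover have "- A - V \<noteq> {}"
  proof
    assume "- A - V = {}"
    then have "UNIV = A \<union> V" by blast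
    then show False
      using A(1) V(1) by (metis bounded_Un not_bounded_UNIV)
  qed
  ultimately show False
    using connected_Int_frontier[OF A(2)] by blast
qed

text \<open>
  Two lifts of one arc that share their ends but differ somewhere bound a cycle: cut both at the
  last common parameter before and at the first common parameter after a point of disagreement.
\<close>

lemma arc_lifts_with_same_ends_agree:
  fixes p :: "complex poly" and f g :: "real \<Rightarrow> complex"
  assumes deg: "degree p > 0"
    and A: "bounded A" "connected (- A)" "interior A = {}"
    and \<alpha>: "inj_on \<alpha> {0..1}" "\<alpha> ` {0..1} \<subseteq> A"
    and f: "continuous_on {0..1} f" "\<And>t. t \<in> {0..1} \<Longrightarrow> poly p (f t) = \<alpha> t"
    and g: "continuous_on {0..1} g" "\<And>t. t \<in> {0..1} \<Longrightarrow> poly p (g t) = \<alpha> t"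
    and ends: "f 0 = g 0" "f 1 = g 1"
    and t: "t \<in> {0..1}"
  shows "f t = g t"
proof (rule ccontr)
  assume ne: "f t \<noteq> g t"
  define E where "E = {t \<in> {0..1}. f t = g t}"
  have "closed {t \<in> {0..1}. f t - g t = 0}"
    using f(1) g(1) by (intro continuous_closed_preimage_constant continuous_intros) auto
  then have "closed E"
    by (simp add: E_def)
  then have E: "compact (E \<inter> {0..t})" "compact (E \<inter> {t..1})"
    by (auto intro: closed_Int_compact)
  have E': "0 \<in> E \<inter> {0..t}" "1 \<in> E \<inter> {t..1}"
    using t ends by (auto simp: E_def)
  obtain t1 where t1: "t1 \<in> E \<inter> {0..t}" "\<And>x. x \<in> E \<inter> {0..t} \<Longrightarrow> x \<le> t1"
    using compact_attains_sup[OF E(1)] E'(1) by blast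
  obtain t2 where t2: "t2 \<in> E \<inter> {t..1}" "\<And>x. x \<in> E \<inter> {t..1} \<Longrightarrow> t2 \<le> x"
    using compact_attains_inf[OF E(2)] E'(2) by blast
  have ord: "0 \<le> t1" "t1 < t" "t < t2" "t2 \<le> 1"
    using t1(1) t2(1) ne by (auto simp: E_def less_le)
  have between: "x = t1 \<or> x = t2" if "x \<in> E" "t1 \<le> x" "x \<le> t2" for x
    using t1(2)[of x] t2(2)[of x] that ord by (force simp: E_def)
  \<comment> \<open>Both curves lie over the injective arc \<open>\<alpha>\<close>, so they can only meet at equal parameters.\<close>
  have inj: "x = y" if "x \<in> {0..1}" "y \<in> {0..1}" "poly p (h x) = poly p (k y)"
    "h = f \<or> h = g" "k = f \<or> k = g" for x y h k
    using that f(2) g(2) inj_onD[OF \<alpha>(1)] by metis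
  have paths: "path f" "path g"
    using f(1) g(1) by (auto simp: path_def)
  have I: "{t1..t2} \<subseteq> {0..1}"
    using ord by auto
  have "inj_on f {t1..t2}"
    using I by (intro inj_onI inj[of _ _ f f]) auto
  moreover have "inj_on g {t1..t2}"
    using I by (intro inj_onI inj[of _ _ g g]) auto
  ultimately have injs: "inj_on f {t1..t2}" "inj_on g {t1..t2}" .
  let ?\<gamma> = "subpath t1 t2 f +++ subpath t2 t1 g"
  have arcs: "arc (subpath t1 t2 f)" "arc (subpath t2 t1 g)"
    using paths ord I injs by (auto simp: arc_subpath_eq closed_segment_eq_real_ivl intro!: path_subpath)
  have imgs: "path_image (subpath t1 t2 f) = f ` {t1..t2}" "path_image (subpath t2 t1 g) = g ` {t1..t2}"
    using ord by (auto simp: path_image_subpath_gen closed_segment_eq_real_ivl)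
  have "f t1 = g t1" "f t2 = g t2"
    using t1(1) t2(1) by (auto simp: E_def)
  moreover have "f ` {t1..t2} \<inter> g ` {t1..t2} \<subseteq> {f t1, g t2}"
  proof
    fix w assume "w \<in> f ` {t1..t2} \<inter> g ` {t1..t2}"
    then obtain x y where xy: "w = f x" "w = g y" "x \<in> {t1..t2}" "y \<in> {t1..t2}" by blast
    then have "x = y"
      using inj[of x y f g] I by auto
    then have "x \<in> E"
      using xy I by (auto simp: E_def)
    then show "w \<in> {f t1, g t2}"
      using between[of x] xy \<open>x = y\<close> by auto
  qed
  ultimately have "simple_path ?\<gamma>"
    using arcs imgs by (intro simple_path_join_loop) auto
  moreover have "pathfinish ?\<gamma> = pathstart ?\<gamma>"
    using \<open>f t1 = g t1\<close> by simp
  moreover have "poly p ` path_image ?\<gamma> \<subseteq> A"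
  proof -
    have "path_image ?\<gamma> = f ` {t1..t2} \<union> g ` {t1..t2}"
      using \<open>f t2 = g t2\<close> by (subst path_image_join) (simp_all add: imgs)
    moreover have "poly p (f x) \<in> A" "poly p (g x) \<in> A" if "x \<in> {t1..t2}" for x
      using f(2)[of x] g(2)[of x] \<alpha>(2) I that by auto
    ultimately show ?thesis by auto
  qed
  ultimately show False
    using poly_loop_not_over_nonseparating_set[OF deg A] by blast
qed

section \<open>Logarithms and winding numbers\<close>

text \<open>
  Both \<open>f\<close> and the constant \<open>f b\<close> are logarithms of the constant \<open>1\<close>, and logarithms are unique
  up to their value at one point. In this form differences of logarithms are seen to be constant.
\<close>

lemma continuous_exp_eq_1_constant:
  fixes f :: "real \<Rightarrow> complex"
  assumes "continuous_on UNIV f" "\<And>t. exp (f t) = 1"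
  shows "f a = f b"
  by (rule covering_space_lift_unique[OF covering_space_exp_punctured_plane,
        where f = "\<lambda>_. 1" and T = UNIV and ?g2.0 = "\<lambda>_. f b" and a = b])
     (use assms in auto)

text \<open>
  A homeomorphism of the plane carries a disc onto the inside of the image of its boundary, and a
  Jordan curve winds once around every point of its inside. The sign depends on the orientation.
\<close>

lemma homeomorphic_circle_winding_number:
  fixes \<psi> \<psi>' :: "complex \<Rightarrow> complex"
  assumes \<psi>: "homeomorphism UNIV UNIV \<psi> \<psi>'" and "r \<noteq> 0"
  shows "winding_number (\<psi> \<circ> circlepath x r) (\<psi> x) \<in> {1, -1}"
proof -
  have cont: "continuous_on UNIV \<psi>" "continuous_on UNIV \<psi>'"
    and inv: "\<psi>' (\<psi> y) = y" "\<psi> (\<psi>' y) = y" for y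
    using \<psi> by (auto simp: homeomorphism_def)
  have inj: "inj \<psi>"
    by (metis inv(1) injI)
  let ?\<gamma> = "\<psi> \<circ> circlepath x r"
  have img: "path_image ?\<gamma> = \<psi> ` sphere x \<bar>r\<bar>"
    by (simp add: path_image_compose)
  have "simple_path ?\<gamma>"
    using assms(2) cont(1) inj
    by (intro simple_path_continuous_image) (auto simp: simple_path_circlepath intro: continuous_on_subset inj_on_subset)
  moreover have "\<psi> x \<in> inside (path_image ?\<gamma>)"
  proof -
    let ?C = "connected_component_set (- path_image ?\<gamma>) (\<psi> x)"
    have x: "\<psi> x \<notin> path_image ?\<gamma>"
      using assms(2) inj by (auto simp: img inj_image_mem_iff)
    have "connected (\<psi>' ` ?C)"
      using cont(2) by (intro connected_continuous_image) (auto intro: continuous_on_subset)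
    moreover have "\<psi>' ` ?C \<inter> ball x \<bar>r\<bar> \<noteq> {}"
      using x assms(2) by (auto simp: inv intro!: image_eqI[of _ _ "\<psi> x"] exI[of _ x])
    moreover have "\<psi>' ` ?C \<inter> frontier (ball x \<bar>r\<bar>) = {}"
    proof -
      have "y \<in> path_image ?\<gamma>" if "\<psi>' y \<in> sphere x \<bar>r\<bar>" for y
        using that unfolding img by (metis imageI inv(2))
      moreover have "?C \<subseteq> - path_image ?\<gamma>"
        by (rule connected_component_subset)
      ultimately show ?thesis
        using assms(2) by (auto simp: frontier_ball)
    qed
    ultimately have "\<psi>' ` ?C \<subseteq> ball x \<bar>r\<bar>"
      using connected_Int_frontier by blast
    then have "?C \<subseteq> \<psi> ` cball x \<bar>r\<bar>"
      by (metis (no_types, lifting) ball_subset_cball image_eqI image_subset_iff inv(2) subsetD subsetI)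
    moreover have "compact (\<psi> ` cball x \<bar>r\<bar>)"
      using cont(1) by (intro compact_continuous_image) (auto intro: continuous_on_subset)
    ultimately have "bounded ?C"
      by (meson bounded_subset compact_imp_bounded)
    then show ?thesis
      using x by (simp add: inside_def)
  qed
  ultimately show ?thesis
    using simple_closed_path_winding_number_inside[of ?\<gamma>] by blast
qed

lemma continuous_logarithm_on_real_line:
  fixes f :: "real \<Rightarrow> complex"
  assumes "continuous_on UNIV f" "\<And>t. f t \<noteq> 0"
  obtains u where "continuous_on UNIV u" "\<And>t. f t = exp (u t)"
  using continuous_logarithm_on_contractible[OF assms(1) convex_imp_contractible[OF convex_UNIV]] assms(2)
  by (metis UNIV_I)

section \<open>Symmetries over complex conjugation\<close>

text \<open>
  Let \<open>\<tau>\<close> denote complex conjugation transported by \<open>\<Psi>\<close>; the map \<open>s\<close> covers \<open>\<tau>\<close>. The arc \<open>\<alpha>\<close> from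
  \<open>c0\<close> to \<open>c1\<close> is fixed by \<open>\<tau>\<close>, so \<open>s\<close> maps each lift of \<open>\<alpha>\<close> starting at \<open>w\<close> to a lift with the same
  ends, hence to itself: near \<open>w\<close> every point over \<open>\<alpha>\<close> is fixed by \<open>s\<close>.

  Consider a small loop around \<open>c0\<close> that crosses \<open>\<alpha>\<close> at time \<open>0\<close> and is run through backwards by
  \<open>\<tau>\<close>. Let \<open>g\<close> be a lift of it near \<open>w\<close>, defined for all times. As \<open>g 0\<close> is fixed by \<open>s\<close>, uniqueness of
  lifts gives \<open>s (g t) = g (- t)\<close>. But \<open>g 1\<close> also lies over \<open>\<alpha>\<close> and is fixed, so \<open>g 1 = g (- 1)\<close>: the
  lift closes up after two turns. Around a root of order \<open>k\<close> a closed lift covers a multiple of \<open>k\<close>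
  turns.
\<close>

lemma real_symmetry_order_dvd_2:
  fixes p :: "complex poly" and s \<Psi> \<Psi>' :: "complex \<Rightarrow> complex"
  assumes deg: "degree p > 0"
    and \<Psi>: "homeomorphism UNIV UNIV \<Psi> \<Psi>'"
    and s: "continuous_on UNIV s" "\<And>z. poly p (s z) = \<Psi>' (cnj (\<Psi> (poly p z)))"
    and crit: "\<And>z. poly (pderiv p) z = 0 \<Longrightarrow> poly p z = c0 \<or> poly p z = c1"
    and c: "c0 \<noteq> c1" "\<Psi> c0 \<in> \<real>" "\<Psi> c1 \<in> \<real>"
    and w: "poly p w = c0" "s w = w"
    and fixed: "\<And>z. poly p z = c1 \<Longrightarrow> s z = z"
  shows "order w (p - [:c0:]) dvd 2"
proof -
  have contP: "continuous_on UNIV \<Psi>" "continuous_on UNIV \<Psi>'"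
    and inv: "\<And>y. \<Psi>' (\<Psi> y) = y" "\<And>y. \<Psi> (\<Psi>' y) = y"
    using \<Psi> by (auto simp: homeomorphism_def)
  obtain x0 x1 :: real where x: "\<Psi> c0 = of_real x0" "\<Psi> c1 = of_real x1"
    using c(2,3) by (auto elim!: Reals_cases)
  have c_inv: "c0 = \<Psi>' (of_real x0)" "c1 = \<Psi>' (of_real x1)"
    using x inv(1) by metis+
  have "x0 \<noteq> x1"
    using c(1) c_inv by auto
  define L where "L = closed_segment (of_real x0) (of_real x1 :: complex)"
  define A where "A = \<Psi>' ` L"
  have "compact A"
    unfolding A_def L_def by (intro compact_continuous_image continuous_on_subset[OF contP(2)]) auto
  then have "bounded A"
    by (rule compact_imp_bounded)
  have "bij \<Psi>'"
    by (metis bijI' inv)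
  then have "- A = \<Psi>' ` (- L)"
    unfolding A_def by (simp add: bij_image_Compl_eq)
  moreover have "connected (- L)"
    unfolding L_def using compact_imp_bounded[OF compact_segment]
    by (intro connected_complement_bounded_convex) auto
  ultimately have "connected (- A)"
    using connected_continuous_image continuous_on_subset[OF contP(2)] by (metis subset_UNIV)
  have "\<Psi>' -` interior A \<subseteq> L"
  proof
    fix x assume "x \<in> \<Psi>' -` interior A"
    then have "\<Psi>' x \<in> A"
      using interior_subset by blast
    then obtain l where "l \<in> L" "\<Psi>' x = \<Psi>' l"
      unfolding A_def by blast
    then show "x \<in> L"
      using inv(2) by metis
  qed
  moreover have "open (\<Psi>' -` interior A)"
    using contP(2) by (intro open_vimage) auto
  moreover have "interior L = {}"
    unfolding L_def by (rule interior_closed_segment_ge2) simp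
  ultimately have "\<Psi>' -` interior A = {}"
    using interior_maximal by blast
  then have "x \<notin> interior A" for x
    using inv(1)[of x] by (metis empty_iff vimageI)
  then have "interior A = {}"
    by blast
  note A = \<open>bounded A\<close> \<open>connected (- A)\<close> \<open>interior A = {}\<close>
  define S where "S = - {c0, c1}"
  have S: "open S" "\<And>z. poly (pderiv p) z = 0 \<Longrightarrow> poly p z \<notin> S"
    using crit by (auto simp: S_def)
  have cover: "covering_space (poly p -` S) (poly p) S"
    by (rule poly_covering_space[OF deg S])

  \<comment> \<open>The arc is the pullback of the segment from \<open>x0\<close> to \<open>x1\<close>, which conjugation fixes.\<close>
  define \<alpha> where "\<alpha> = (\<lambda>t. \<Psi>' (of_real ((1 - t) * x0 + t * x1)))"
  have \<alpha>_cont: "continuous_on {0..1} \<alpha>"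
    unfolding \<alpha>_def by (intro continuous_on_compose2[OF contP(2)] continuous_intros) auto
  have \<alpha>_eq: "\<alpha> t = \<alpha> t' \<longleftrightarrow> t = t'" for t t'
  proof -
    have "\<alpha> t = \<alpha> t' \<longleftrightarrow> (1 - t) * x0 + t * x1 = (1 - t') * x0 + t' * x1"
      unfolding \<alpha>_def using inv(2) by (metis of_real_eq_iff)
    also have "\<dots> \<longleftrightarrow> (t - t') * (x1 - x0) = 0"
      by (simp add: algebra_simps)
    finally show ?thesis
      using \<open>x0 \<noteq> x1\<close> by simp
  qed
  have \<alpha>_ends: "\<alpha> 0 = c0" "\<alpha> 1 = c1"
    by (simp_all add: \<alpha>_def c_inv)
  have \<alpha>_S: "\<alpha> ` {0<..<1} \<subseteq> S"
  proof
    fix z assume "z \<in> \<alpha> ` {0<..<1}"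
    then obtain t where "z = \<alpha> t" "0 < t" "t < 1" by auto
    then show "z \<in> S"
      using \<alpha>_eq[of t 0] \<alpha>_eq[of t 1] by (simp add: S_def \<alpha>_ends)
  qed
  have \<alpha>_A: "\<alpha> ` {0..1} \<subseteq> A"
  proof -
    have "complex_of_real ((1 - t) * x0 + t * x1) \<in> L" if "t \<in> {0..1}" for t
      unfolding L_def in_segment using that by (intro exI[of _ t]) (auto simp: scaleR_conv_of_real)
    then show ?thesis by (auto simp: \<alpha>_def A_def)
  qed
  have \<alpha>_inj: "inj_on \<alpha> {0..1}"
    by (auto simp: inj_on_def \<alpha>_eq)
  have lift_fixed: "s (g t) = g t"
    if g: "continuous_on {0..1} g" "\<And>t. t \<in> {0..1} \<Longrightarrow> poly p (g t) = \<alpha> t" "g 0 = w" "t \<in> {0..1}" for g t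
  proof (rule arc_lifts_with_same_ends_agree[OF deg A \<alpha>_inj \<alpha>_A])
    show "continuous_on {0..1} (\<lambda>t. s (g t))"
      using g(1) by (intro continuous_on_compose2[OF s(1)]) auto
    show "poly p (s (g t)) = \<alpha> t" if "t \<in> {0..1}" for t
      using g(2)[OF that] by (simp add: s(2) \<alpha>_def inv)
    show "s (g 0) = g 0" "s (g 1) = g 1"
      using g(2)[of 1] g(3) w(2) fixed \<alpha>_ends by auto
  qed (use g in auto)

  define k where "k = order w (p - [:c0:])"
  obtain q where q: "p - [:c0:] = [:- w, 1:] ^ k * q" "poly q w \<noteq> 0"
    using order_decomp[OF minus_const_nonzero[OF deg, of c0], of w] unfolding k_def
    by (auto simp: poly_eq_0_iff_dvd)
  have p_eq: "poly p z - c0 = (z - w) ^ k * poly q z" for z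
    using arg_cong[OF q(1), of "\<lambda>q. poly q z"] by simp
  obtain e0 where e0: "e0 > 0"
    and sep0: "\<And>z z'. poly p z = c0 \<Longrightarrow> poly p z' = c0 \<Longrightarrow> dist z z' < 2 * e0 \<Longrightarrow> z = z'"
    using poly_roots_separated[OF deg] by blast
  have "isCont (poly q) w"
    by simp
  then obtain e1 where e1: "e1 > 0" "\<And>z. dist w z < e1 \<Longrightarrow> poly q z \<noteq> 0"
    using continuous_at_avoid[of w "poly q" 0] q(2) by auto
  define e where "e = min e0 e1"
  have "e > 0"
    using e0 e1 by (simp add: e_def)
  have sep: "z = z'" if "poly p z = c0" "poly p z' = c0" "dist z z' < 2 * e" for z z'
    using sep0 that by (simp add: e_def)
  have q_ne: "poly q z \<noteq> 0" if "z \<in> ball w e" for z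
    using e1(2) that by (simp add: e_def)
  obtain d where "d > 0"
    and near: "\<And>x. cmod (poly p x - c0) < d \<Longrightarrow> \<exists>z. poly p z = c0 \<and> dist z x < e"
    using poly_near_root[OF deg \<open>e > 0\<close>] by blast
  have "c0 \<in> poly p ` ball w e"
    using w(1) \<open>e > 0\<close> by force
  then obtain d' where "d' > 0" and d': "ball c0 d' \<subseteq> poly p ` ball w e"
    using open_poly_image[OF deg open_ball] by (meson open_contains_ball)
  have "isCont \<Psi>' (of_real x0)"
    using contP(2) by (simp add: continuous_on_eq_continuous_at)
  then obtain \<rho> where "\<rho> > 0"
    and \<rho>: "\<And>y. dist y (of_real x0) < \<rho> \<Longrightarrow> dist (\<Psi>' y) c0 < min d d'"
    using \<open>d > 0\<close> \<open>d' > 0\<close> c_inv(1) unfolding continuous_at_eps_delta by (metis min_less_iff_conj)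
  \<comment> \<open>The loop is the pullback of the circle of radius \<open>\<bar>r\<bar>\<close> about \<open>x0\<close>. The sign of \<open>r\<close> points
    towards \<open>x1\<close>, so the circle meets the segment at time \<open>0\<close>, at parameter \<open>\<theta>\<close> of the arc.\<close>
  define \<theta> where "\<theta> = min (1 / 2) (\<rho> / (2 * \<bar>x1 - x0\<bar>))"
  define r where "r = \<theta> * (x1 - x0)"
  have \<theta>: "0 < \<theta>" "\<theta> < 1"
    using \<open>\<rho> > 0\<close> \<open>x0 \<noteq> x1\<close> by (auto simp: \<theta>_def)
  have "\<theta> \<le> \<rho> / (2 * \<bar>x1 - x0\<bar>)"
    by (simp add: \<theta>_def)
  moreover have abs_r: "\<bar>r\<bar> = \<theta> * \<bar>x1 - x0\<bar>"
    using \<theta> by (simp add: r_def abs_mult)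
  ultimately have "\<bar>r\<bar> \<le> \<rho> / 2"
    using \<open>x0 \<noteq> x1\<close> by (simp add: pos_le_divide_eq)
  then have r: "r \<noteq> 0" "\<bar>r\<bar> < \<rho>" "\<bar>r\<bar> < \<bar>x1 - x0\<bar>"
  proof -
    show "r \<noteq> 0"
      using \<theta> \<open>x0 \<noteq> x1\<close> by (simp add: r_def)
    show "\<bar>r\<bar> < \<rho>"
      using \<open>\<bar>r\<bar> \<le> \<rho> / 2\<close> \<open>\<rho> > 0\<close> by linarith
    show "\<bar>r\<bar> < \<bar>x1 - x0\<bar>"
      using \<theta> \<open>x0 \<noteq> x1\<close> by (simp add: abs_r)
  qed

  \<comment> \<open>The lift of the arc through \<open>z\<close> is followed back to parameter \<open>0\<close>; it stays near \<open>w\<close> and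
    must therefore end there.\<close>
  have fixed_near: "s z = z" if z: "dist w z < e" "poly p z = \<alpha> \<theta>" for z
  proof -
    obtain h where h: "continuous_on {0..1} h" "h \<theta> = z" "\<And>t. t \<in> {0..1} \<Longrightarrow> poly p (h t) = \<alpha> t"
      using lift_arc_through_point[OF deg S \<alpha>_cont \<alpha>_S _ z(2)] \<theta> by auto
    have small: "cmod (poly p (h t) - c0) < d" if "t \<in> {0..\<theta>}" for t
    proof -
      have "dist (complex_of_real ((1 - t) * x0 + t * x1)) (of_real x0) = \<bar>(1 - t) * x0 + t * x1 - x0\<bar>"
        unfolding dist_of_real dist_real_def ..
      also have "(1 - t) * x0 + t * x1 - x0 = t * (x1 - x0)"
        by (simp add: algebra_simps)
      also have "\<bar>t * (x1 - x0)\<bar> = t * \<bar>x1 - x0\<bar>"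
        using that by (simp add: abs_mult)
      also have "\<dots> \<le> \<bar>r\<bar>"
        unfolding abs_r using that by (intro mult_right_mono) auto
      finally have "dist (\<alpha> t) c0 < d"
        using \<rho> r(2) by (simp add: \<alpha>_def)
      then show ?thesis
        using h(3)[of t] that \<theta> by (simp add: dist_norm)
    qed
    have "dist w (h 0) < e"
    proof (rule lift_stays_near_root[OF near sep _ _ small w(1), where ?t0.0 = \<theta>])
      show "continuous_on {0..\<theta>} h"
        using \<theta> by (intro continuous_on_subset[OF h(1)]) auto
    qed (use \<theta> h(2) z(1) in auto)
    then have "h 0 = w"
      using sep[OF w(1), of "h 0"] h(3)[of 0] \<alpha>_ends(1) \<open>e > 0\<close> by simp
    then show ?thesis
      using lift_fixed[OF h(1,3), of \<theta>] h(2) \<theta> by simp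
  qed

  define loop where "loop = (\<lambda>t. \<Psi>' (of_real x0 + of_real r * exp (2 * of_real pi * \<i> * of_real t)))"
  have l_cont: "continuous_on UNIV loop"
    unfolding loop_def by (intro continuous_on_compose2[OF contP(2)] continuous_intros) auto
  have l_shift: "loop (t + 1) = loop t" for t
    by (simp add: loop_def exp_add distrib_left)
  have l_\<alpha>: "loop 0 = \<alpha> \<theta>" "loop 1 = \<alpha> \<theta>"
    by (simp_all add: loop_def \<alpha>_def r_def algebra_simps)
  have l_near: "dist (loop t) c0 < min d d'" for t
    unfolding loop_def using r(2) by (intro \<rho>) (simp add: dist_norm norm_mult)
  have l_ne: "loop t \<noteq> c0" "loop t \<noteq> c1" for t
  proof -
    have *: "dist (\<Psi> (loop t)) (of_real x0) = \<bar>r\<bar>"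
      by (simp add: loop_def inv dist_norm norm_mult)
    show "loop t \<noteq> c0"
      using * r(1) x(1) by auto
    show "loop t \<noteq> c1"
      using * r(3) x(2) by (auto simp: dist_real_def)
  qed
  then have l_S: "loop \<in> UNIV \<rightarrow> S"
    by (auto simp: S_def)
  have l_sym: "\<Psi>' (cnj (\<Psi> (loop t))) = loop (- t)" for t
    by (simp add: loop_def inv exp_cnj)

  have "loop 0 \<in> ball c0 d'"
    using l_near[of 0] by (simp add: dist_commute)
  with d' obtain z0 where z0: "dist w z0 < e" "poly p z0 = loop 0"
    by (auto simp: image_iff subset_iff)
  have "z0 \<in> poly p -` S"
    using z0(2) l_S by auto
  have "\<exists>g. continuous_on UNIV g \<and> g \<in> UNIV \<rightarrow> poly p -` S \<and> g 0 = z0 \<and> (\<forall>t. poly p (g t) = loop t)"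
    by (rule covering_space_lift_strong[OF cover \<open>z0 \<in> poly p -` S\<close> UNIV_I[of 0]
          convex_imp_simply_connected[OF convex_UNIV] convex_imp_locally_path_connected[OF convex_UNIV]
          l_cont l_S z0(2)[symmetric]]) blast
  then obtain g where g: "continuous_on UNIV g" "g \<in> UNIV \<rightarrow> poly p -` S" "g 0 = z0"
      "\<And>t. poly p (g t) = loop t"
    by blast
  have g_near: "dist w (g t) < e" for t
  proof (rule lift_stays_near_root[OF near sep g(1) connected_UNIV _ w(1), where ?t0.0 = 0])
    show "cmod (poly p (g t) - c0) < d" for t
      using l_near[of t] by (simp add: g(4) dist_norm)
    show "dist w (g 0) < e"
      using z0(1) g(3) by simp
  qed auto
  have g_sym: "s (g t) = g (- t)" for t
  proof (rule covering_space_lift_unique[OF cover, where f = "\<lambda>t. loop (- t)" and a = 0 and T = UNIV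
        and ?g1.0 = "\<lambda>t. s (g t)" and ?g2.0 = "\<lambda>t. g (- t)" and x = t])
    show "s (g 0) = g (- 0)"
      using fixed_near[of z0] z0 g(3) l_\<alpha> by simp
    show "continuous_on UNIV (\<lambda>t. s (g t))"
      by (intro continuous_on_compose2[OF s(1) g(1)]) auto
    show "continuous_on UNIV (\<lambda>t. loop (- t))"
      by (intro continuous_on_compose2[OF l_cont] continuous_intros) auto
    show "continuous_on UNIV (\<lambda>t. g (- t))"
      by (intro continuous_on_compose2[OF g(1)] continuous_intros) auto
    show eq: "loop (- t) = poly p (s (g t))" for t
      by (simp add: s(2) g(4) l_sym)
    show "(\<lambda>t. s (g t)) \<in> UNIV \<rightarrow> poly p -` S"
      using l_S by (auto simp flip: eq)
  qed (use l_S g(2,4) in auto)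
  have "s (g 1) = g 1"
    using g_near[of 1] g(4)[of 1] l_\<alpha>(2) by (intro fixed_near) auto
  then have g_closed: "g (- 1) = g 1"
    using g_sym[of 1] by simp

  have "continuous_on UNIV (\<lambda>t. loop t - c0)" "loop t - c0 \<noteq> 0" for t
    by (intro continuous_intros l_cont) (simp add: l_ne)
  \<comment> \<open>Logarithms along the loop and its lift turn the counting of turns into additive identities:
    \<open>u\<close> belongs to \<open>loop - c0\<close>, \<open>v\<close> to \<open>g - w\<close>, and \<open>y\<close> to the cofactor of \<open>(z - w) ^ k\<close>.\<close>
  then obtain u where u: "continuous_on UNIV u" "\<And>t. loop t - c0 = exp (u t)"
    using continuous_logarithm_on_real_line by blast
  have g_ne: "g t \<noteq> w" for t
    using g(4)[of t] l_ne(1) w(1) by metis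
  have "continuous_on UNIV (\<lambda>t. g t - w)" "g t - w \<noteq> 0" for t
    by (intro continuous_intros g(1)) (simp add: g_ne)
  then obtain v where v: "continuous_on UNIV v" "\<And>t. g t - w = exp (v t)"
    using continuous_logarithm_on_real_line by blast
  have "continuous_on (ball w e) (poly q)"
    by (intro continuous_intros)
  then have "\<exists>y. continuous_on (ball w e) y \<and> (\<forall>z\<in>ball w e. poly q z = exp (y z))"
    by (rule continuous_logarithm_on_ball[OF _ q_ne]) blast+
  then obtain y where y: "continuous_on (ball w e) y" "\<And>z. z \<in> ball w e \<Longrightarrow> poly q z = exp (y z)"
    by blast
  have "u 1 - of_nat k * v 1 - y (g 1) = u (- 1) - of_nat k * v (- 1) - y (g (- 1))"
  proof (rule continuous_exp_eq_1_constant)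
    show "continuous_on UNIV (\<lambda>t. u t - of_nat k * v t - y (g t))"
      using g_near by (intro continuous_intros u(1) v(1) continuous_on_compose2[OF y(1) g(1)]) auto
    show "exp (u t - of_nat k * v t - y (g t)) = 1" for t
    proof -
      have "exp (u t) = exp (v t) ^ k * exp (y (g t))"
        using p_eq[of "g t"] y(2)[of "g t"] g_near[of t] by (simp add: g(4) u(2) v(2))
      then show ?thesis
        by (simp add: exp_diff exp_of_nat_mult)
    qed
  qed
  then have u_k: "u 1 - u (- 1) = of_nat k * (v 1 - v (- 1))"
    by (simp add: g_closed algebra_simps)
  have "exp (v 1) = exp (v (- 1))"
    using v(2) g_closed by metis
  then obtain n :: int where n: "v 1 - v (- 1) = of_int (2 * n) * pi * \<i>"
    unfolding exp_eq by force
  \<comment> \<open>Both turns contribute the same amount.\<close>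
  have "u (0 + 1) - u 0 = u (- 1 + 1) - u (- 1)"
  proof (rule continuous_exp_eq_1_constant)
    show "continuous_on UNIV (\<lambda>t. u (t + 1) - u t)"
      by (intro continuous_intros u(1) continuous_on_compose2[OF u(1)]) auto
    show "exp (u (t + 1) - u t) = 1" for t
      using u(2)[of t] u(2)[of "t + 1"] by (simp add: exp_diff l_shift)
  qed
  then have u2: "u 1 - u (- 1) = 2 * (u 1 - u 0)"
    by simp
  have "winding_number (\<Psi>' \<circ> circlepath (of_real x0) r) c0 = winding_number (exp \<circ> u) 0"
    by (subst winding_number_offset) (simp add: u(2) [symmetric] loop_def circlepath comp_def)
  also have "\<dots> = (u 1 - u 0) / (2 * of_real pi * \<i>)"
    using winding_number_compose_exp[of u] u(1) continuous_on_subset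
    by (auto simp: path_def pathfinish_def pathstart_def)
  finally have "(u 1 - u 0) / (2 * of_real pi * \<i>) \<in> {1, -1}"
    using homeomorphic_circle_winding_number[OF homeomorphism_symD[OF \<Psi>] r(1), of "of_real x0"]
    by (simp add: c_inv)
  then obtain m :: int where m: "u 1 - u 0 = of_int m * (2 * of_real pi * \<i>)" "m = 1 \<or> m = -1"
    by (auto simp: field_simps intro: that[of 1] that[of "-1"])
  have "of_int (2 * m) * (2 * of_real pi * \<i>) = of_int (int k * n) * (2 * of_real pi * \<i>)"
    using u_k u2 unfolding m n by (simp add: algebra_simps)
  then have "of_int (2 * m) = (of_int (int k * n) :: complex)"
    by simp
  then have "2 * m = int k * n"
    by (simp only: of_int_eq_iff)
  then have "int k dvd 2 * m"
    by simp
  then have "int k dvd 2"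
    using m(2) by auto
  then show ?thesis
    unfolding k_def using int_dvd_int_iff[of _ 2] by simp
qed

section \<open>Topological invariance of the order of a root\<close>

lemma order_linear_power_times:
  fixes q :: "complex poly"
  assumes "poly q z \<noteq> 0"
  shows "order z ([:- z, 1:] ^ n * q) = n"
proof -
  have "q \<noteq> 0"
    using assms by auto
  then show ?thesis
    using assms by (subst order_mult) (auto simp: order_power_n_n order_0I)
qed

text \<open>
  The cofactor of the \<open>n\<close>-th power of \<open>x - z\<close> has no zero near \<open>z\<close>, hence an \<open>n\<close>-th root there.
\<close>

lemma poly_local_power:
  fixes p :: "complex poly" and z :: complex
  assumes deg: "degree p > 0"
  defines "n \<equiv> order z (p - [:poly p z:])"
  obtains r h where "r > 0" "h holomorphic_on ball z r" "inj_on h (ball z r)" "h z = 0"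
    "\<And>x. x \<in> ball z r \<Longrightarrow> poly p x - poly p z = h x ^ n" "n > 0"
proof -
  have nz: "p - [:poly p z:] \<noteq> 0"
    by (rule minus_const_nonzero[OF deg])
  then have "n > 0"
    using order_root[of "p - [:poly p z:]" z] unfolding n_def by simp
  obtain q where q: "p - [:poly p z:] = [:- z, 1:] ^ n * q" "poly q z \<noteq> 0"
    using order_decomp[OF nz, of z] unfolding n_def by (auto simp: poly_eq_0_iff_dvd)
  have p_eq: "poly p x - poly p z = (x - z) ^ n * poly q x" for x
    using arg_cong[OF q(1), of "\<lambda>q. poly q x"] by simp
  have "isCont (poly q) z"
    by simp
  then obtain e where e: "e > 0" "\<And>x. dist z x < e \<Longrightarrow> poly q x \<noteq> 0"
    using continuous_at_avoid[of z "poly q" 0] q(2) by auto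
  have "\<exists>y. y holomorphic_on ball z e \<and> (\<forall>x\<in>ball z e. poly q x = exp (y x))"
    by (rule contractible_imp_holomorphic_log[OF holomorphic_on_poly convex_imp_contractible[OF convex_ball]])
       (use e(2) in auto)
  then obtain y where y: "y holomorphic_on ball z e" "\<And>x. x \<in> ball z e \<Longrightarrow> poly q x = exp (y x)"
    by blast
  define h where "h = (\<lambda>x. (x - z) * exp (y x / of_nat n))"
  have hol: "h holomorphic_on ball z e"
    unfolding h_def using y(1) \<open>n > 0\<close> by (intro holomorphic_intros) auto
  have pow: "poly p x - poly p z = h x ^ n" if "x \<in> ball z e" for x
    using that \<open>n > 0\<close> by (simp add: p_eq y(2) h_def power_mult_distrib flip: exp_of_nat_mult)
  have yd: "(y has_field_derivative deriv y z) (at z)"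
    using y(1) e(1) by (intro holomorphic_derivI[of y "ball z e"]) auto
  have "(h has_field_derivative exp (y z / of_nat n)) (at z)"
    unfolding h_def by (rule derivative_eq_intros yd refl)+ (use \<open>n > 0\<close> in auto)
  then have "deriv h z \<noteq> 0"
    by (simp add: DERIV_imp_deriv)
  then obtain r where r: "r > 0" "ball z r \<subseteq> ball z e" "inj_on h (ball z r)"
    using has_complex_derivative_locally_injective[OF hol] e(1) by (metis centre_in_ball open_ball)
  show thesis
  proof (rule that[of r h])
    show "h holomorphic_on ball z r"
      using hol r(2) by (rule holomorphic_on_subset)
    show "poly p x - poly p z = h x ^ n" if "x \<in> ball z r" for x
      using pow r(2) that by blast
  qed (use r \<open>n > 0\<close> in \<open>auto simp: h_def\<close>)
qed

text \<open>
  In the local coordinate \<open>h\<close> the polynomial is an \<open>n\<close>-th power, so near \<open>z\<close> its fibres have at most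
  \<open>n\<close> points, and fibres with exactly \<open>n\<close> points occur arbitrarily close to \<open>z\<close>. The right-hand side
  only speaks of neighbourhoods and fibres; therefore the order can be transported by topological maps.
\<close>

lemma order_iff_fibre_near:
  fixes p :: "complex poly"
  assumes deg: "degree p > 0"
  shows "m \<le> order z (p - [:poly p z:]) \<longleftrightarrow>
    (\<forall>r>0. \<exists>X c. X \<subseteq> ball z r \<and> card X = m \<and> poly p ` X \<subseteq> {c})"
proof -
  define n where "n = order z (p - [:poly p z:])"
  obtain r0 h where r0: "r0 > 0" and h: "h holomorphic_on ball z r0" "inj_on h (ball z r0)" "h z = 0"
    and pow: "\<And>x. x \<in> ball z r0 \<Longrightarrow> poly p x - poly p z = h x ^ n" and "n > 0"
    using poly_local_power[OF deg, of z] unfolding n_def by blast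
  have roots: "finite {w :: complex. w ^ n = c} \<and> card {w :: complex. w ^ n = c} \<le> n" for c
  proof (cases "c = 0")
    case True
    then have "{w :: complex. w ^ n = c} = {0}"
      using \<open>n > 0\<close> by auto
    then show ?thesis using \<open>n > 0\<close> by simp
  next
    case False
    then show ?thesis
      using \<open>n > 0\<close> by (simp add: card_nth_roots finite_nth_roots)
  qed
  have "\<exists>X c. X \<subseteq> ball z r \<and> card X = m \<and> poly p ` X \<subseteq> {c}" if leq: "m \<le> n" and "r > 0" for r
  proof -
    define B where "B = ball z (min r r0)"
    have B: "open B" "z \<in> B" "B \<subseteq> ball z r0" "B \<subseteq> ball z r"
      using \<open>r > 0\<close> r0 by (auto simp: B_def)
    have "open (h ` B)"
      using h B(1,3) by (intro open_mapping_thm3) (auto intro: holomorphic_on_subset inj_on_subset)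
    moreover have "0 \<in> h ` B"
      using B(2) h(3) by force
    ultimately obtain \<epsilon> where \<epsilon>: "\<epsilon> > 0" "ball 0 \<epsilon> \<subseteq> h ` B"
      by (meson open_contains_ball)
    define c :: complex where "c = of_real (\<epsilon> / 2) ^ n"
    have "c \<noteq> 0"
      using \<epsilon>(1) by (simp add: c_def)
    then have "card {w. w ^ n = c} = n"
      using \<open>n > 0\<close> by (rule card_nth_roots)
    then obtain Y where Y: "Y \<subseteq> {w. w ^ n = c}" "card Y = m"
      using obtain_subset_with_card_n[of m "{w. w ^ n = c}"] leq by auto
    have "norm w < \<epsilon>" if "w ^ n = c" for w
    proof -
      have "norm w ^ n = (\<epsilon> / 2) ^ n"
        using arg_cong[OF that, of norm] \<epsilon>(1) by (simp add: c_def norm_power)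
      then have "norm w = \<epsilon> / 2"
        using \<open>n > 0\<close> \<epsilon>(1) by (intro power_eq_imp_eq_base[of "norm w" n]) auto
      then show ?thesis using \<epsilon>(1) by simp
    qed
    then have "Y \<subseteq> ball 0 \<epsilon>"
      using Y(1) by auto
    with \<epsilon>(2) have "Y \<subseteq> h ` B"
      by (rule order_trans[rotated])
    then obtain X where X: "X \<subseteq> B" "Y = h ` X"
      by (meson subset_imageE)
    have "card X = m"
      using Y(2) X h(2) B(3) by (metis card_image inj_on_subset)
    moreover have "poly p ` X \<subseteq> {c + poly p z}"
    proof (rule image_subsetI)
      fix x assume "x \<in> X"
      then have "x \<in> ball z r0" "h x ^ n = c"
        using X Y(1) B(3) by blast+
      then have "poly p x - poly p z = c"
        using pow by simp
      then show "poly p x \<in> {c + poly p z}"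
        by (simp add: algebra_simps)
    qed
    ultimately show ?thesis
      using X(1) B(4) by blast
  qed
  moreover have "m \<le> n" if "X \<subseteq> ball z r0" "card X = m" "poly p ` X \<subseteq> {c}" for X c
  proof -
    have "h ` X \<subseteq> {w. w ^ n = c - poly p z}"
      using pow that(1,3) by (auto simp: image_subset_iff subset_iff simp flip: pow)
    then have "card (h ` X) \<le> n"
      using roots[of "c - poly p z"] card_mono by (metis order_trans)
    moreover have "card (h ` X) = m"
      using that(1,2) h(2) by (metis card_image inj_on_subset)
    ultimately show ?thesis by simp
  qed
  ultimately show ?thesis
    unfolding n_def [symmetric] using r0 by meson
qed

lemma order_le_of_equivariant:
  fixes p :: "complex poly" and s T :: "complex \<Rightarrow> complex"
  assumes deg: "degree p > 0"
    and s: "continuous_on UNIV s" "inj s" "\<And>z. poly p (s z) = T (poly p z)"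
  shows "order z (p - [:poly p z:]) \<le> order (s z) (p - [:poly p (s z):])"
  unfolding order_iff_fibre_near[OF deg, where z = "s z"]
proof (intro allI impI)
  fix r :: real assume "r > 0"
  have "isCont s z"
    using s(1) by (simp add: continuous_on_eq_continuous_at)
  then obtain r' where r': "r' > 0" "s ` ball z r' \<subseteq> ball (s z) r"
    using \<open>r > 0\<close> continuous_at_ball by blast
  obtain X c where X: "X \<subseteq> ball z r'" "card X = order z (p - [:poly p z:])" "poly p ` X \<subseteq> {c}"
    using order_iff_fibre_near[OF deg, of "order z (p - [:poly p z:])" z] r'(1) by blast
  show "\<exists>X c. X \<subseteq> ball (s z) r \<and> card X = order z (p - [:poly p z:]) \<and> poly p ` X \<subseteq> {c}"
  proof (intro exI conjI)
    show "s ` X \<subseteq> ball (s z) r"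
      using X(1) r'(2) by blast
    show "card (s ` X) = order z (p - [:poly p z:])"
      using X(2) s(2) by (metis card_image inj_on_subset subset_UNIV)
    show "poly p ` s ` X \<subseteq> {T c}"
      using X(3) s(3) by auto
  qed
qed

lemma critical_if_order_ge_2:
  fixes p :: "complex poly"
  assumes "2 \<le> order z (p - [:c:])"
  shows "poly (pderiv p) z = 0"
proof -
  obtain q where q: "p - [:c:] = [:- z, 1:] ^ 2 * q"
    using assms order_divides by blast
  have "pderiv p = pderiv (p - [:c:])"
    by (simp add: pderiv_diff pderiv_pCons)
  also have "\<dots> = pderiv ([:- z, 1:] * ([:- z, 1:] * q))"
    unfolding q by (simp only: power2_eq_square mult.assoc)
  finally show ?thesis
    by (simp only: pderiv_mult poly_add poly_mult) simp
qed

section \<open>From topological equivalence to a symmetry of the plane\<close>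

lemma complexify_commutes_with_conjugation:
  "eval2 (complexify g) (cnj x, cnj y) = cnj (eval2 (complexify g) (x, y))"
proof (induction g)
  case 0
  then show ?case
    by (simp add: complexify_def eval2_def)
next
  case (pCons a g)
  have step: "eval2 (complexify (pCons a g)) (x, y)
      = poly (map_poly complex_of_real a) x + y * eval2 (complexify g) (x, y)" for x y
    by (simp add: complexify_def eval2_def map_poly_pCons)
  have "poly (map_poly complex_of_real a) (cnj x) = cnj (poly (map_poly complex_of_real a) x)"
    by (induction a) (simp_all add: map_poly_pCons)
  then show ?case
    using pCons.IH by (simp add: step)
qed

lemma constant_of_finite_range:
  fixes f :: "complex \<Rightarrow> complex"
  assumes "continuous_on UNIV f" "finite (range f)"
  shows "f x = f y"
proof -
  have "f constant_on UNIV"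
    by (rule continuous_finite_range_constant[OF connected_UNIV assms])
  then show ?thesis
    by (auto simp: constant_on_def)
qed

text \<open>
  Conjugation of the two coordinates preserves the fibres of the real polynomial; transported to the
  other side it becomes an involution \<open>\<sigma>\<close> covering \<open>\<Psi>' \<circ> cnj \<circ> \<Psi>\<close>. For a polynomial in the first
  variable alone, \<open>\<sigma>\<close> maps each line \<open>{x} \<times> UNIV\<close> continuously into finitely many such lines, hence
  into a single one. So it induces an involution \<open>s\<close> of the space of lines, which is the plane.
\<close>

lemma equivalence_to_real_gives_symmetry:
  fixes p :: "complex poly"
  assumes deg: "degree p > 0" and equiv: "[:p:] \<approx>\<^sub>t\<^sub>o\<^sub>p complexify g"
  obtains \<Psi> \<Psi>' s where "homeomorphism UNIV UNIV \<Psi> \<Psi>'" "continuous_on UNIV s" "\<And>z. s (s z) = z"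
    "\<And>z. poly p (s z) = \<Psi>' (cnj (\<Psi> (poly p z)))"
proof -
  obtain \<Phi> \<Phi>' \<Psi> \<Psi>' where \<Phi>: "homeomorphism UNIV UNIV \<Phi> \<Phi>'" and \<Psi>: "homeomorphism UNIV UNIV \<Psi> \<Psi>'"
    and eq: "eval2 (complexify g) \<circ> \<Phi> = \<Psi> \<circ> eval2 [:p:]"
    using equiv unfolding top_equivalent_def by blast
  have inv: "\<Psi>' (\<Psi> y) = y" "\<Phi>' (\<Phi> z) = z" "\<Phi> (\<Phi>' z) = z" for y z
    using homeomorphism_apply1[OF \<Psi>] homeomorphism_apply1[OF \<Phi>] homeomorphism_apply2[OF \<Phi>] by auto
  have cont: "continuous_on UNIV \<Phi>" "continuous_on UNIV \<Phi>'"
    using \<Phi> by (auto simp: homeomorphism_def)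
  have f: "eval2 [:p:] z = poly p (fst z)" for z
    by (simp add: eval2_def split: prod.split)
  have g\<Phi>: "eval2 (complexify g) (\<Phi> z) = \<Psi> (poly p (fst z))" for z
    using fun_cong[OF eq, of z] by (simp add: f)
  define conj where "conj = (\<lambda>z :: complex \<times> complex. (cnj (fst z), cnj (snd z)))"
  define \<sigma> where "\<sigma> = (\<lambda>z. \<Phi>' (conj (\<Phi> z)))"
  have \<sigma>_inv: "\<sigma> (\<sigma> z) = z" for z
    by (simp add: \<sigma>_def conj_def inv)
  have \<sigma>_cont: "continuous_on UNIV \<sigma>"
    unfolding \<sigma>_def conj_def
    by (intro continuous_on_compose2[OF cont(2)] continuous_intros cont(1)) auto
  have \<sigma>_p: "poly p (fst (\<sigma> z)) = \<Psi>' (cnj (\<Psi> (poly p (fst z))))" for z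
  proof -
    have "\<Psi> (poly p (fst (\<sigma> z))) = eval2 (complexify g) (conj (\<Phi> z))"
      by (simp add: \<sigma>_def inv flip: g\<Phi>)
    also have "\<dots> = cnj (\<Psi> (poly p (fst z)))"
      by (simp add: conj_def complexify_commutes_with_conjugation g\<Phi>)
    finally show ?thesis
      using inv(1) by metis
  qed
  define s where "s = (\<lambda>x. fst (\<sigma> (x, 0)))"
  have fib: "fst (\<sigma> (x, y)) = s x" for x y
  proof -
    have "continuous_on UNIV (\<lambda>y. fst (\<sigma> (x, y)))"
      by (intro continuous_intros continuous_on_compose2[OF \<sigma>_cont]) auto
    moreover have "finite (range (\<lambda>y. fst (\<sigma> (x, y))))"
    proof (rule finite_subset)
      let ?q = "p - [:\<Psi>' (cnj (\<Psi> (poly p x))):]"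
      show "range (\<lambda>y. fst (\<sigma> (x, y))) \<subseteq> {z. poly ?q z = 0}"
        by (auto simp: \<sigma>_p)
      show "finite {z. poly ?q z = 0}"
        by (rule poly_roots_finite[OF minus_const_nonzero[OF deg]])
    qed
    ultimately show ?thesis
      unfolding s_def by (rule constant_of_finite_range)
  qed
  show thesis
  proof (rule that[OF \<Psi>])
    show "continuous_on UNIV s"
      unfolding s_def by (intro continuous_intros continuous_on_compose2[OF \<sigma>_cont]) auto
    show "s (s x) = x" for x
    proof -
      have "s (s x) = fst (\<sigma> (fst (\<sigma> (x, 0)), snd (\<sigma> (x, 0))))"
        by (simp only: fib)
      then show ?thesis
        by (simp add: \<sigma>_inv)
    qed
    show "poly p (s z) = \<Psi>' (cnj (\<Psi> (poly p z)))" for z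
      using \<sigma>_p[of "(z, 0)"] by (simp add: s_def)
  qed
qed

section \<open>A chiral polynomial\<close>

text \<open>
  Write \<open>a\<close> for the double root. The derivative has to be a multiple of \<open>z\<^sup>2 (z - 1)\<^sup>2 (z - a)\<close>, and the values at \<open>0\<close> and \<open>a\<close>
  have to agree. Integrating from \<open>0\<close> to \<open>a\<close> turns this into \<open>2 a\<^sup>2 - 6 a + 5 = 0\<close>, with the two
  conjugate solutions \<open>(3 \<plusminus> \<i>) / 2\<close>; they belong to the two mirror images of the tree. The remaining
  simple root is \<open>2 / a\<close>.
\<close>

definition chiral_double_root :: complex where
  "chiral_double_root = Complex (3/2) (1/2)"

definition chiral_simple_root :: complex where
  "chiral_simple_root = Complex (6/5) (-2/5)"

text \<open>
  The factor \<open>[:- 0, 1:]\<close> is the variable, written in the shape \<open>[:- z, 1:]\<close> in which orders are read off.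
\<close>

definition chiral_poly :: "complex poly" where
  "chiral_poly = [:- 0, 1:] ^ 3 * ([:- chiral_double_root, 1:] ^ 2 * [:- chiral_simple_root, 1:])"

lemma chiral_poly_eq:
  "chiral_poly = [:0, 0, 0, Complex (-3) (-1), Complex 6 (3/2), Complex (-21/5) (-3/5), 1:]"
  by (simp add: chiral_poly_def chiral_double_root_def chiral_simple_root_def eval_nat_numeral complex_eq_iff)

lemma chiral_poly_at_1:
  "chiral_poly - [:Complex (-1/5) (-1/10):]
     = [:- 1, 1:] ^ 3 * [:Complex (-1/5) (-1/10), Complex (-3/5) (-3/10), Complex (-6/5) (-3/5), 1:]"
  by (simp add: chiral_poly_eq eval_nat_numeral complex_eq_iff)

lemma pderiv_chiral_poly:
  "pderiv chiral_poly = smult 6 ([:0, 1:] ^ 2 * [:- 1, 1:] ^ 2 * [:- chiral_double_root, 1:])"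
  by (simp add: chiral_poly_eq chiral_double_root_def eval_nat_numeral complex_eq_iff pderiv_pCons)


lemma chiral_constants:
  "chiral_double_root \<noteq> 0" "chiral_simple_root \<noteq> 0" "chiral_double_root \<noteq> 1"
  "chiral_simple_root \<noteq> 1" "chiral_double_root \<noteq> chiral_simple_root"
  by (simp_all add: chiral_double_root_def chiral_simple_root_def complex_eq_iff)

lemma degree_chiral_poly: "degree chiral_poly > 0"
  by (simp add: chiral_poly_eq)

lemma chiral_poly_zero_iff:
  "poly chiral_poly z = 0 \<longleftrightarrow> z \<in> {0, chiral_double_root, chiral_simple_root}"
  by (auto simp: chiral_poly_def)

lemma chiral_poly_1: "poly chiral_poly 1 = Complex (-1/5) (-1/10)"
  by (simp add: chiral_poly_eq complex_eq_iff)

lemma critical_point_chiral_poly: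
  "poly (pderiv chiral_poly) z = 0 \<longleftrightarrow> z \<in> {0, 1, chiral_double_root}"
  by (auto simp: pderiv_chiral_poly)

lemma order_chiral_poly:
  "order 0 (chiral_poly - [:poly chiral_poly 0:]) = 3"
  "order chiral_double_root (chiral_poly - [:poly chiral_poly chiral_double_root:]) = 2"
  "order 1 (chiral_poly - [:poly chiral_poly 1:]) = 3"
proof -
  have zero: "chiral_poly - [:poly chiral_poly 0:] = chiral_poly"
    "chiral_poly - [:poly chiral_poly chiral_double_root:] = chiral_poly"
    using chiral_poly_zero_iff by simp_all
  have a_first: "chiral_poly = [:- chiral_double_root, 1:] ^ 2 * ([:- 0, 1:] ^ 3 * [:- chiral_simple_root, 1:])"
    unfolding chiral_poly_def by (simp only: mult_ac)
  show "order 0 (chiral_poly - [:poly chiral_poly 0:]) = 3"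
    unfolding zero unfolding chiral_poly_def
    by (rule order_linear_power_times) (use chiral_constants in simp)
  show "order chiral_double_root (chiral_poly - [:poly chiral_poly chiral_double_root:]) = 2"
    unfolding zero
    by (subst a_first, rule order_linear_power_times) (use chiral_constants in simp)
  show "order 1 (chiral_poly - [:poly chiral_poly 1:]) = 3"
    unfolding chiral_poly_1 chiral_poly_at_1
    by (rule order_linear_power_times) (simp add: complex_eq_iff)
qed

section \<open>A polynomial without real model\<close>

theorem theoremA:
  shows "\<exists>f :: complex poly poly. \<forall>g :: real poly poly. \<not> (f \<approx>\<^sub>t\<^sub>o\<^sub>p complexify g)"
proof (rule exI[of _ "[:chiral_poly:]"], intro allI notI)
  fix g :: "real poly poly"
  let ?p = chiral_poly
  assume "[:?p:] \<approx>\<^sub>t\<^sub>o\<^sub>p complexify g"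
  then obtain \<Psi> \<Psi>' s where \<Psi>: "homeomorphism UNIV UNIV \<Psi> \<Psi>'"
    and s: "continuous_on UNIV s" "\<And>z. s (s z) = z" "\<And>z. poly ?p (s z) = \<Psi>' (cnj (\<Psi> (poly ?p z)))"
    using equivalence_to_real_gives_symmetry[OF degree_chiral_poly] by blast
  have "inj s"
    by (metis injI s(2))
  define ord where "ord = (\<lambda>z. order z (?p - [:poly ?p z:]))"
  have ord: "ord 0 = 3" "ord chiral_double_root = 2" "ord 1 = 3"
    using order_chiral_poly by (simp_all add: ord_def)
  have "ord z \<le> ord (s z)" for z
    unfolding ord_def by (rule order_le_of_equivariant[OF degree_chiral_poly s(1) \<open>inj s\<close> s(3)])
  from this this[of "s _"] have ord_s: "ord (s z) = ord z" for z
    by (metis order_antisym s(2))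
  have critical: "z \<in> {0, 1, chiral_double_root}" if "2 \<le> ord z" for z
    using critical_if_order_ge_2[OF that[unfolded ord_def]] critical_point_chiral_poly by simp
  have same_fibre: "poly ?p (s x) = poly ?p (s y)" if "poly ?p x = poly ?p y" for x y
    using that by (simp add: s(3))

  \<comment> \<open>The order separates the double root from the other two critical points, and the value
    separates those from each other; the simple root is what remains in the fibre over \<open>0\<close>.\<close>
  have s_a: "s chiral_double_root = chiral_double_root"
    using critical[of "s chiral_double_root"] ord_s[of chiral_double_root] ord by auto
  have zeros: "s z \<in> {0, chiral_double_root, chiral_simple_root}"
    if "z \<in> {0, chiral_double_root, chiral_simple_root}" for z
  proof -
    have "poly ?p z = poly ?p chiral_double_root"
      using that chiral_poly_zero_iff[of z] chiral_poly_zero_iff[of chiral_double_root] by simp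
    then have "poly ?p (s z) = poly ?p chiral_double_root"
      using same_fibre[of z chiral_double_root] s_a by simp
    then show ?thesis
      using chiral_poly_zero_iff[of "s z"] chiral_poly_zero_iff[of chiral_double_root] by simp
  qed
  have s_0: "s 0 = 0"
  proof -
    have "s 0 \<in> {0, 1, chiral_double_root}"
      using critical[of "s 0"] ord_s[of 0] ord by simp
    then show ?thesis
      using zeros[of 0] ord_s[of 0] ord chiral_constants by auto
  qed
  have s_1: "s 1 = 1"
    using critical[of "s 1"] ord_s[of 1] ord s_0 injD[OF \<open>inj s\<close>, of 1 0] by auto
  have s_b: "s chiral_simple_root = chiral_simple_root"
    using zeros[of chiral_simple_root] s_0 s_a chiral_constants injD[OF \<open>inj s\<close>, of chiral_simple_root 0]
      injD[OF \<open>inj s\<close>, of chiral_simple_root chiral_double_root] by auto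

  have real: "\<Psi> (poly ?p z) \<in> \<real>" if "s z = z" for z
  proof -
    have "cnj (\<Psi> (poly ?p z)) = \<Psi> (poly ?p z)"
      using s(3)[of z] that homeomorphism_apply2[OF \<Psi>] by (metis UNIV_I)
    then show ?thesis
      by (simp add: Reals_cnj_iff)
  qed
  have "order 1 (?p - [:poly ?p 1:]) dvd 2"
  proof (rule real_symmetry_order_dvd_2[OF degree_chiral_poly \<Psi> s(1,3)])
    show "poly ?p z = poly ?p 1 \<or> poly ?p z = 0" if "poly (pderiv ?p) z = 0" for z
      using that critical_point_chiral_poly chiral_poly_zero_iff by auto
    show "poly ?p 1 \<noteq> 0"
      by (simp add: chiral_poly_1 complex_eq_iff)
    show "\<Psi> (poly ?p 1) \<in> \<real>"
      by (rule real[OF s_1])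
    show "\<Psi> 0 \<in> \<real>"
      using real[OF s_0] chiral_poly_zero_iff[of 0] by simp
    show "s z = z" if "poly ?p z = 0" for z
      using that s_0 s_a s_b by (auto simp: chiral_poly_zero_iff)
  qed (simp_all add: s_1)
  then show False
    by (simp add: order_chiral_poly)
qed

end
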